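(* Let $\psi$ be a conformal map on the unit disk $\mathbb{D}$ with $\psi(0)=0$, and for $\alpha>0$ let $F_\alpha=\{z\in\mathbb{D}:|\psi(z)|=\alpha\}$. If ${\tt h}(\psi)$ denotes the Hardy number of $\psi$, then $${\tt h}(\psi)=\liminf_{\alpha\to+\infty}\frac{d_{\mathbb{D}}(0,F_\alpha)}{\log\alpha}.$$
   Context: A conformal map on $\mathbb{D}=\{z\in\mathbb{C}:|z|<1\}$ is an injective holomorphic function $\psi:\mathbb{D}\to\mathbb{C}$. Hyperbolic distance: for $z,w\in\mathbb{D}$, $d_{\mathbb{D}}(z,w)=\log\frac{1+\left|\frac{z-w}{1-z\bar w}\right|}{1-\left|\frac{z-w}{1-z\bar w}\right|}$; for a set $E\subset\mathbb{D}$, $d_{\mathbb{D}}(z,E)=\inf\{d_{\mathbb{D}}(z,w):w\in E\}$ (with $\inf\emptyset=+\infty$). Hardy space: for $p>0$, $H^p(\mathbb{D})$ is the set of holomorphic $f$ on $\mathbb{D}$ with $\sup_{0<r<1}\int_0^{2\pi}|f(re^{i\theta})|^p\,d\theta<+\infty$. Hardy number: ${\tt h}(\psi)=\sup\{p>0:\psi\in H^p(\mathbb{D})\}\in[1/2,+\infty]$. *)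

theory Defs
  imports "HOL-Complex_Analysis.Complex_Analysis"
begin

abbreviation unit_disk :: "complex set" where
  "unit_disk \<equiv> ball 0 1"

text \<open>Functions on the disk are represented by total functions of type \<^typ>\<open>complex \<Rightarrow> complex\<close>;
  only their values on the unit disk matter.\<close>

definition conformal_map :: "(complex \<Rightarrow> complex) \<Rightarrow> bool" where
  "conformal_map \<psi> \<longleftrightarrow> \<psi> holomorphic_on unit_disk \<and> inj_on \<psi> unit_disk"

definition hyp_dist :: "complex \<Rightarrow> complex \<Rightarrow> real" where
  "hyp_dist z w =
     ln ((1 + cmod ((z - w) / (1 - z * cnj w))) / (1 - cmod ((z - w) / (1 - z * cnj w))))"

text \<open>The infimum is taken in the extended reals, so the distance to the empty set is \<open>\<infinity>\<close>.\<close>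

definition hyp_dist_set :: "complex \<Rightarrow> complex set \<Rightarrow> ereal" where
  "hyp_dist_set z E = (INF w\<in>E. ereal (hyp_dist z w))"

text \<open>The integrand is continuous in \<open>\<theta>\<close> for holomorphic \<open>f\<close> and \<open>p > 0\<close>, so the integral is
  never the default value of a non-integrable function.\<close>

definition hardy_space :: "real \<Rightarrow> (complex \<Rightarrow> complex) set" where
  "hardy_space p = {f. f holomorphic_on unit_disk \<and>
     (SUP r\<in>{0<..<1::real}.
        ereal (integral {0..2 * pi} (\<lambda>\<theta>. cmod (f (of_real r * exp (\<i> * of_real \<theta>))) powr p))) < \<infinity>}"

definition hardy_number :: "(complex \<Rightarrow> complex) \<Rightarrow> ereal" where
  "hardy_number \<psi> = (SUP p\<in>{p. p > 0 \<and> \<psi> \<in> hardy_space p}. ereal p)"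

definition level_set :: "(complex \<Rightarrow> complex) \<Rightarrow> real \<Rightarrow> complex set" where
  "level_set \<psi> \<alpha> = {z \<in> unit_disk. cmod (\<psi> z) = \<alpha>}"

end

(* Write \<psi>(z) = z exp (L z) and, for Re s < 0, \<Lambda>(s) = s + L(exp s), a logarithm of \<psi>(exp s).

   If \<psi> is in H^p, then |exp (p L)| = |\<psi>(z)/z|^p, and Cauchy's formula on circles gives
   |\<psi>(z)|^p <= C / (1 - |z|). As d(0,z) >= log (1 / (1 - |z|)), this bounds d(0,F_\<alpha>) below by
   p log \<alpha> - log C.

   Conversely, a lower bound q log \<alpha> <= d(0,F_\<alpha>) for large \<alpha> means |\<psi>(z)| <= C (1 - |z|)^(-1/q).
   Let I(t) be the integral of |\<psi>|^p over the circle of radius exp t. By the Hardy-Stein identity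
   I'' is the integral of p^2 |\<Lambda>'|^2 |\<psi>|^p, and since \<psi> is injective, integrating this over t
   gives a multiple of the area of a plane set contained in a disk of radius
   sup {|\<psi>(z)|^(p/2) : |z| <= exp t}. Hence I'(t) <= A + B |t|^(-p/q), which is integrable at 0 for
   p < q, so I is bounded.

   That the Hardy number is positive (needed when the lower limit is not known to be positive) follows
   from Bloch's theorem: the image of \<Lambda> on a small disk cannot contain two points that differ by
   2 pi i, so |\<Lambda>'(s)| <= C / |Re s| and \<psi> grows polynomially. *)

theory Submission
  imports Defs "HOL-Real_Asymp.Real_Asymp"
begin

section \<open>Change of variables in the plane for injective maps\<close>

subsection \<open>Areas of injective images of rectangles\<close>

no_notation fps_nth (infixl \<open>$\<close> 75)

lemma ex_2: "(\<exists>i::2. P i) \<longleftrightarrow> P 1 \<or> P 2"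
  by (metis exhaust_2)

text \<open>The change of variables theorem lives on \<open>real^2\<close>, whereas integrals over
  polar rectangles are iterated. The coordinate bijection onto \<open>real * real\<close> maps boxes
  to boxes of equal content, and Fubini for continuous integrands does the rest.\<close>

lemma integral_cbox_real2:
  fixes f :: "real \<Rightarrow> real \<Rightarrow> 'a::banach"
  assumes cont: "continuous_on (cbox (a, c) (b, d)) (\<lambda>(s, t). f s t)"
  shows "((\<lambda>x::real^2. f (x $ 1) (x $ 2)) has_integral integral {a..b} (\<lambda>s. integral {c..d} (f s)))
    (cbox (vector [a, c]) (vector [b, d]))"
proof -
  let ?g = "\<lambda>x::real^2. (x $ 1, x $ 2)"
  let ?h = "\<lambda>(s, t). vector [s, t] :: real^2"
  have hg: "?h (?g x) = x" for x
    by (simp add: vec_eq_iff forall_2)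
  have gh: "?g (?h x) = x" for x
    by (cases x) simp
  have g_box: "?g ` cbox u v = cbox (u $ 1, u $ 2) (v $ 1, v $ 2)" for u v
  proof (intro equalityI subsetI)
    fix y assume "y \<in> cbox (u $ 1, u $ 2) (v $ 1, v $ 2)"
    then have "?h y \<in> cbox u v"
      by (cases y) (auto simp: mem_box_cart forall_2)
    then show "y \<in> ?g ` cbox u v"
      by (intro image_eqI[where x="?h y"]) (simp_all only: gh)
  qed (auto simp: mem_box_cart forall_2)
  have h_box: "?h ` cbox (u1, u2) (v1, v2) = cbox (vector [u1, u2]) (vector [v1, v2])" for u1 u2 v1 v2
  proof -
    have "?h ` cbox (u1, u2) (v1, v2) = ?h ` (?g ` cbox (vector [u1, u2]) (vector [v1, v2]))"
      by (simp add: g_box)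
    also have "\<dots> = cbox (vector [u1, u2]) (vector [v1, v2])"
      by (simp only: image_image hg image_ident)
    finally show ?thesis .
  qed
  have content: "measure lborel (?g ` cbox u v) = 1 * measure lborel (cbox u v)" for u v
    by (simp add: g_box content_cbox_if_cart content_Pair UNIV_2 content_real_if interval_eq_empty_cart ex_2)
  have "((\<lambda>(s, t). f s t) has_integral integral (cbox (a, c) (b, d)) (\<lambda>(s, t). f s t)) (cbox (a, c) (b, d))"
    using cont by (intro integrable_integral integrable_continuous)
  note twiddle = has_integral_twiddle[where r=1 and g="?g" and h="?h", OF _ hg gh _ _ _ content this]
  have "((\<lambda>x. f (x $ 1) (x $ 2)) has_integral integral (cbox (a, c) (b, d)) (\<lambda>(s, t). f s t))
      (?h ` cbox (a, c) (b, d))"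
  proof -
    have "continuous (at x) ?g" for x
      by (intro continuous_intros)
    moreover have "\<exists>w z. ?h ` cbox u v = cbox w z" for u v
      using h_box[of "fst u" "snd u" "fst v" "snd v"] by auto
    ultimately show ?thesis
      using g_box twiddle by auto
  qed
  then show ?thesis
    using integral_prod_continuous[OF cont] by (simp only: h_box prod.case cbox_interval[where 'a=real])
qed

text \<open>\<open>Im (cnj u * v)\<close> is the determinant with columns u and v, so
  \<open>jac\<close> is the absolute Jacobian of the real derivative. By injectivity its integral is
  the area of the image, which fits in a square of side 2R. \<open>F\<close> need not be
  holomorphic, so radial stretches are covered.\<close>

lemma integral_jacobian_le:
  fixes F :: "complex \<Rightarrow> complex" and F' :: "complex \<Rightarrow> complex \<Rightarrow> complex"
  defines "jac \<equiv> \<lambda>s t. \<bar>Im (cnj (F' (Complex s t) 1) * F' (Complex s t) \<i>)\<bar>"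
  assumes der: "\<And>z. z \<in> box (Complex a c) (Complex b d) \<Longrightarrow> (F has_derivative F' z) (at z)"
    and inj: "inj_on F (box (Complex a c) (Complex b d))"
    and bound: "\<And>z. z \<in> box (Complex a c) (Complex b d) \<Longrightarrow> cmod (F z) \<le> R"
    and cont: "continuous_on (cbox (a, c) (b, d)) (\<lambda>(s, t). jac s t)"
    and R: "0 \<le> R"
  shows "integral {a..b} (\<lambda>s. integral {c..d} (jac s)) \<le> (2 * R)\<^sup>2"
proof -
  define C where "C = (\<lambda>x::real^2. Complex (x $ 1) (x $ 2))"
  define V where "V = (\<lambda>w. vector [Re w, Im w] :: real^2)"
  have blC: "bounded_linear C"
    unfolding C_def linear_conv_bounded_linear[symmetric]
    by (rule linearI) (auto simp: complex_eq_iff)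
  have blV: "bounded_linear V"
    unfolding V_def linear_conv_bounded_linear[symmetric]
    by (rule linearI) (auto simp: vec_eq_iff forall_2)
  define S where "S = (box (vector [a, c]) (vector [b, d]) :: (real^2) set)"
  have CS: "C x \<in> box (Complex a c) (Complex b d)" if "x \<in> S" for x
    using that by (auto simp: S_def C_def mem_box_cart forall_2 in_box_complex_iff)
  define f where "f = V \<circ> F \<circ> C"
  define f' where "f' = (\<lambda>x. V \<circ> F' (C x) \<circ> C)"
  have der_f: "(f has_derivative f' x) (at x within S)" if "x \<in> S" for x
  proof -
    have "(F has_derivative F' (C x)) (at (C x) within C ` S)"
      using der[OF CS[OF that]] has_derivative_at_withinI by blast
    then show ?thesis
      unfolding f_def f'_def comp_assoc
      by (intro diff_chain_within bounded_linear_imp_has_derivative blC)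
        (auto intro: bounded_linear_imp_has_derivative blV simp: comp_def)
  qed
  have det: "\<bar>det (matrix (f' x))\<bar> = jac (x $ 1) (x $ 2)" for x
    by (simp add: f'_def det_2 matrix_def V_def C_def axis_def jac_def algebra_simps
        flip: one_complex.code imaginary_unit.code)
  have inj_f: "inj_on f S"
  proof (rule inj_onI)
    fix x y assume xy: "x \<in> S" "y \<in> S" "f x = f y"
    then have "F (C x) = F (C y)"
      by (auto simp: f_def V_def vec_eq_iff forall_2 complex_eq_iff)
    with xy CS inj have "C x = C y"
      by (auto dest: inj_onD)
    then show "x = y"
      by (auto simp: C_def vec_eq_iff forall_2)
  qed
  \<comment> \<open>The boundary of the box is a null set, so the integral over the closed box is
    also the one over the open set \<open>S\<close>.\<close>
  have hi: "((\<lambda>x. \<bar>det (matrix (f' x))\<bar>) has_integral integral {a..b} (\<lambda>s. integral {c..d} (jac s))) S"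
    unfolding S_def has_integral_open_interval det by (rule integral_cbox_real2[OF cont])
  have S: "S \<in> sets lebesgue"
    by (simp add: S_def)
  have "integral {a..b} (\<lambda>s. integral {c..d} (jac s)) = measure lebesgue (f ` S)"
    using measure_differentiable_image_eq[OF S der_f inj_f has_integral_integrable[OF hi]]
      integral_unique[OF hi] by simp
  also have "\<dots> \<le> measure lebesgue (cbox (vector [-R, -R]) (vector [R, R]) :: (real^2) set)"
  proof (rule measure_mono_fmeasurable)
    show "f ` S \<subseteq> cbox (vector [-R, -R]) (vector [R, R])"
    proof clarify
      fix x assume "x \<in> S"
      from bound[OF CS[OF this]] show "f x \<in> cbox (vector [-R, -R]) (vector [R, R])"
        using abs_Re_le_cmod[of "F (C x)"] abs_Im_le_cmod[of "F (C x)"]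
        by (auto simp: f_def V_def mem_box_cart forall_2)
    qed
    show "f ` S \<in> sets lebesgue"
      using measurable_differentiable_image_eq[OF S der_f inj_f] has_integral_integrable[OF hi]
      by auto
  qed auto
  also have "\<dots> = (2 * R)\<^sup>2"
    using R by (simp add: content_cbox_if_cart UNIV_2 interval_eq_empty_cart ex_2 power2_eq_square)
  finally show ?thesis .
qed

section \<open>Logarithmic coordinates on the left half-plane\<close>

subsection \<open>The logarithm of a conformal map\<close>

lemma has_vector_derivative_along_line:
  fixes f :: "complex \<Rightarrow> complex"
  assumes "(f has_field_derivative D) (at (u + v * of_real x))"
  shows "((\<lambda>x::real. f (u + v * of_real x)) has_vector_derivative v * D) (at x)"
proof -
  have "((\<lambda>z. u + v * z) has_field_derivative v) (at (of_real x))"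
    by (auto intro!: derivative_eq_intros)
  from DERIV_chain2[OF assms this] show ?thesis
    using has_vector_derivative_real_field[where f="\<lambda>z. f (u + v * z)"] by (simp add: mult.commute)
qed

locale conformal_log =
  fixes \<psi> L :: "complex \<Rightarrow> complex"
  assumes hol_L: "L holomorphic_on unit_disk"
    and psi_eq: "\<And>z. z \<in> unit_disk \<Longrightarrow> \<psi> z = z * exp (L z)"
    and inj: "inj_on \<psi> unit_disk"
begin

definition lam :: "complex \<Rightarrow> complex" where
  "lam s = s + L (exp s)"

text \<open>The derivative of \<open>lam\<close>; in terms of z = exp s it is z psi'(z) /
  psi(z).\<close>

definition dlam :: "complex \<Rightarrow> complex" where
  "dlam s = 1 + exp s * deriv L (exp s)"

abbreviation left_half_plane :: "complex set" where
  "left_half_plane \<equiv> {s. Re s < 0}"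

lemma exp_in_disk: "Re s < 0 \<Longrightarrow> exp s \<in> unit_disk"
  by simp

lemma hol_psi: "\<psi> holomorphic_on unit_disk"
proof -
  have "(\<lambda>z. z * exp (L z)) holomorphic_on unit_disk"
    by (intro holomorphic_intros hol_L)
  then show ?thesis
    using psi_eq by (metis (no_types, lifting) holomorphic_cong)
qed

lemma exp_lam: "Re s < 0 \<Longrightarrow> exp (lam s) = \<psi> (exp s)"
  by (simp add: lam_def exp_add psi_eq)

lemma cmod_psi_exp: "Re s < 0 \<Longrightarrow> cmod (\<psi> (exp s)) = exp (Re (lam s))"
  by (simp flip: exp_lam)

text \<open>Injectivity of \<open>\<psi>\<close> gives exp s = exp s', and the bound on the
  imaginary parts excludes a nonzero multiple of 2 pi i.\<close>

lemma exp_lam_inj: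
  assumes "Re s < 0" "Re s' < 0" "exp (lam s) = exp (lam s')" "\<bar>Im s - Im s'\<bar> < 2 * pi"
  shows "s = s'"
proof -
  have "exp s = exp s'"
    using assms inj exp_in_disk by (metis exp_lam inj_onD)
  then show ?thesis
    using assms(4) exp_complex_eqI by blast
qed

lemma open_left_half_plane: "open left_half_plane"
  by (simp add: open_halfspace_Re_lt)

lemma has_field_derivative_lam:
  assumes "Re s < 0"
  shows "(lam has_field_derivative dlam s) (at s)"
proof -
  have "(L has_field_derivative deriv L (exp s)) (at (exp s))"
    using assms hol_L by (intro holomorphic_derivI[where S=unit_disk]) auto
  from DERIV_chain2[OF this DERIV_exp] show ?thesis
    unfolding lam_def[abs_def] dlam_def by (auto intro!: derivative_eq_intros)
qed

lemma holomorphic_lam: "lam holomorphic_on left_half_plane"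
  using has_field_derivative_lam open_left_half_plane
  by (auto simp: holomorphic_on_open)

lemma holomorphic_dlam: "dlam holomorphic_on left_half_plane"
proof -
  have "deriv L \<circ> exp holomorphic_on left_half_plane"
    by (rule holomorphic_on_compose_gen[where t=unit_disk])
      (auto intro!: holomorphic_intros hol_L)
  then show ?thesis
    unfolding dlam_def[abs_def] by (auto intro!: holomorphic_intros simp: comp_def)
qed

lemmas continuous_on_lam = holomorphic_on_imp_continuous_on[OF holomorphic_lam]
  and continuous_on_dlam = holomorphic_on_imp_continuous_on[OF holomorphic_dlam]

lemma has_field_derivative_dlam:
  "Re s < 0 \<Longrightarrow> (dlam has_field_derivative deriv dlam s) (at s)"
  using holomorphic_dlam open_left_half_plane by (intro holomorphic_derivI) auto

lemma lam_periodic: "lam (s + \<i> * of_real (2 * pi)) = lam s + \<i> * of_real (2 * pi)"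
  and dlam_periodic: "dlam (s + \<i> * of_real (2 * pi)) = dlam s"
  by (simp_all add: lam_def dlam_def exp_add mult.commute)

section \<open>A polynomial growth bound from Bloch's theorem\<close>

subsection \<open>Polynomial growth\<close>

text \<open>Bloch's theorem with constant 1/12: were the bound to fail, the image of a disk of
  radius -Re s would contain a disk of radius above 2 pi = 24 pi / 12, hence two points differing by
  2 pi i, against \<open>exp_lam_inj\<close>.\<close>

lemma norm_dlam_le:
  assumes "-1 \<le> Re s" "Re s < 0"
  shows "cmod (dlam s) \<le> 24 * pi / (- Re s)"
proof (rule ccontr)
  define r where "r = - Re s"
  have r: "0 < r" "r \<le> 1"
    using assms by (auto simp: r_def)
  have sub: "ball s r \<subseteq> left_half_plane"
  proof
    fix z assume "z \<in> ball s r"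
    then have "\<bar>Re (s - z)\<bar> < r"
      using abs_Re_le_cmod[of "s - z"] by (simp add: dist_norm)
    then show "z \<in> left_half_plane"
      by (simp add: r_def)
  qed
  assume "\<not> cmod (dlam s) \<le> 24 * pi / (- Re s)"
  then have big: "r * cmod (dlam s) / 12 > 2 * pi"
    using r by (simp add: r_def field_simps)
  obtain b where b: "ball b (r * norm (deriv lam s) / 12) \<subseteq> lam ` ball s r"
    using Bloch[OF holomorphic_on_subset[OF holomorphic_lam sub] r(1) order_refl] by blast
  have "deriv lam s = dlam s"
    using has_field_derivative_lam assms(2) by (simp add: DERIV_imp_deriv)
  moreover have "0 < r * cmod (dlam s)"
    using big pi_gt_zero by linarith
  ultimately have "b \<in> lam ` ball s r" "b + \<i> * of_real (2 * pi) \<in> lam ` ball s r"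
    using big by (auto intro!: subsetD[OF b] simp: dist_norm norm_mult)
  then obtain x y where xy: "x \<in> ball s r" "y \<in> ball s r" "lam x = b" "lam y = b + \<i> * of_real (2 * pi)"
    by (metis imageE)
  \<comment> \<open>The condition -1 <= Re s keeps the radius at most 1, so both preimages lie in a
    strip of height below 2 pi.\<close>
  have "\<bar>Im (s - x)\<bar> < 1" "\<bar>Im (s - y)\<bar> < 1"
    using xy r abs_Im_le_cmod[of "s - x"] abs_Im_le_cmod[of "s - y"] by (auto simp: dist_norm)
  then have "\<bar>Im x - Im y\<bar> < 2 * pi"
    using pi_gt3 by simp
  moreover have "exp (lam x) = exp (lam y)"
    using xy by (simp add: exp_add mult.commute)
  ultimately have "x = y"
    using exp_lam_inj xy sub by blast
  then show False
    using xy by simp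
qed

text \<open>The bound on \<open>dlam\<close> is integrated along a radius starting at |z| = 1/e; the
  smaller closed disk is handled by compactness.\<close>

lemma polynomial_growth:
  obtains C K where "C > 0" "K > 0" "\<And>z. z \<in> unit_disk \<Longrightarrow> cmod (\<psi> z) \<le> C * (1 - cmod z) powr (- K)"
proof -
  define K where "K = 24 * pi"
  have "K > 0"
    by (simp add: K_def)
  have sub: "cball 0 (exp (-1)) \<subseteq> unit_disk"
    by (auto simp: dist_norm) (smt (verit) exp_less_one_iff)
  have "bounded (\<psi> ` cball 0 (exp (-1)))"
    using holomorphic_on_imp_continuous_on[OF hol_psi] sub
    by (intro compact_imp_bounded compact_continuous_image) (auto intro: continuous_on_subset)
  then obtain C where C: "C > 0" "\<And>z. cmod z \<le> exp (-1) \<Longrightarrow> cmod (\<psi> z) \<le> C"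
    unfolding bounded_pos by (auto simp: dist_norm)
  have "cmod (\<psi> z) \<le> C * (1 - cmod z) powr (- K)" if z: "z \<in> unit_disk" for z
  proof (cases "cmod z \<le> exp (-1)")
    case True
    have "1 - cmod z > 0" "1 - cmod z \<le> 1"
      using z by auto
    then have "1 \<le> (1 - cmod z) powr (- K)"
      using \<open>K > 0\<close> by (simp add: powr_minus one_le_inverse_iff powr_le1)
    then show ?thesis
      using C True by (smt (verit) mult_le_cancel_left1)
  next
    case False
    then have z0: "z \<noteq> 0" "exp (-1) < cmod z"
      by auto
    define t \<theta> where "t = ln (cmod z)" and "\<theta> = Arg z"
    have t: "-1 < t" "t < 0"
      using z z0 by (auto simp: t_def ln_less_zero_iff) (metis exp_gt_zero ln_exp ln_less_cancel_iff order.strict_trans)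
    have z_eq: "z = exp (of_real t + \<i> * of_real \<theta>)"
      using z0 Arg_eq[of z] by (simp add: exp_add t_def \<theta>_def exp_of_real)
    \<comment> \<open>The term K ln(-x) has derivative K/x, which absorbs the bound K/|x| on the
      derivative of Re \<open>lam\<close> and makes \<open>u\<close> nonincreasing.\<close>
    define u where "u = (\<lambda>x. Re (lam (\<i> * of_real \<theta> + 1 * of_real x)) + K * ln (- x))"
    have "u t \<le> u (-1)"
    proof (rule DERIV_nonpos_imp_nonincreasing[where f=u])
      show "-1 \<le> t"
        using t by simp
      fix x assume x: "-1 \<le> x" "x \<le> t"
      let ?s = "\<i> * of_real \<theta> + 1 * of_real x"
      have s: "Re ?s = x"
        by simp
      have "((\<lambda>x. lam (\<i> * of_real \<theta> + 1 * of_real x)) has_vector_derivative 1 * dlam ?s) (at x)"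
        using x t by (intro has_vector_derivative_along_line has_field_derivative_lam) simp
      then have "((\<lambda>x. Re (lam (\<i> * of_real \<theta> + 1 * of_real x))) has_real_derivative Re (dlam ?s)) (at x)"
        using has_field_derivative_Re by force
      moreover have "((\<lambda>x. K * ln (- x)) has_real_derivative K / x) (at x)"
        using x t by (auto intro!: derivative_eq_intros)
      ultimately have "(u has_real_derivative Re (dlam ?s) + K / x) (at x)"
        unfolding u_def by (rule DERIV_add)
      moreover have "Re (dlam ?s) + K / x \<le> 0"
        using norm_dlam_le[of ?s] complex_Re_le_cmod[of "dlam ?s"] x t by (simp add: K_def)
      ultimately show "\<exists>y. (u has_real_derivative y) (at x) \<and> y \<le> 0"
        by blast
    qed
    have "cmod (\<psi> z) = exp (Re (lam (\<i> * of_real \<theta> + 1 * of_real t)))"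
      using t by (subst z_eq, subst cmod_psi_exp) (auto simp: add.commute)
    also have "\<dots> = exp (u t) * (- t) powr (- K)"
      using t by (simp add: u_def powr_def flip: exp_add)
    also have "\<dots> \<le> exp (u (-1)) * (- t) powr (- K)"
      using \<open>u t \<le> u (-1)\<close> by (intro mult_right_mono) auto
    also have "\<dots> \<le> C * (1 - cmod z) powr (- K)"
    proof (rule mult_mono)
      have "exp (u (-1)) = cmod (\<psi> (exp (\<i> * of_real \<theta> + 1 * of_real (-1))))"
        by (subst cmod_psi_exp) (auto simp: u_def)
      also have "\<dots> \<le> C"
        by (intro C) simp
      finally show "exp (u (-1)) \<le> C" .
      have "1 - cmod z \<le> - t"
        using ln_le_minus_one[of "cmod z"] z0 by (simp add: t_def)
      then show "(- t) powr (- K) \<le> (1 - cmod z) powr (- K)"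
        using \<open>K > 0\<close> z by (intro powr_mono2') auto
    qed (use C in auto)
    finally show ?thesis .
  qed
  then show ?thesis
    using that \<open>C > 0\<close> \<open>K > 0\<close> by blast
qed

section \<open>Hardy-Stein identity and area bound for means over circles\<close>

subsection \<open>Integral means\<close>

text \<open>This is |psi(exp s)|^p on the left half-plane; the exponential form can be
  differentiated directly.\<close>

definition modulus_powr :: "real \<Rightarrow> complex \<Rightarrow> real" where
  "modulus_powr p s = exp (p * Re (lam s))"

definition pmean :: "real \<Rightarrow> real \<Rightarrow> real" where
  "pmean p t = integral {0..2 * pi} (\<lambda>\<theta>. modulus_powr p (of_real t + \<i> * of_real \<theta>))"

text \<open>The derivative of \<open>pmean\<close> in t, the logarithm of the radius, with
  differentiation carried out under the integral.\<close>

definition pmean_slope :: "real \<Rightarrow> real \<Rightarrow> real" where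
  "pmean_slope p t = integral {0..2 * pi}
    (\<lambda>\<theta>. p * Re (dlam (of_real t + \<i> * of_real \<theta>)) * modulus_powr p (of_real t + \<i> * of_real \<theta>))"

lemma modulus_powr_eq:
  assumes "t < 0"
  shows "modulus_powr p (of_real t + \<i> * of_real \<theta>) =
    cmod (\<psi> (of_real (exp t) * exp (\<i> * of_real \<theta>))) powr p"
proof -
  have "cmod (\<psi> (exp (of_real t + \<i> * of_real \<theta>))) powr p = modulus_powr p (of_real t + \<i> * of_real \<theta>)"
    using assms by (subst cmod_psi_exp) (auto simp: modulus_powr_def powr_def)
  then show ?thesis
    by (simp add: exp_add exp_of_real)
qed

lemma continuous_on_polar:
  assumes "continuous_on left_half_plane f"
  shows "continuous_on ({..<0} \<times> X) (\<lambda>(t, \<theta>). f (of_real t + \<i> * of_real \<theta>))"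
  unfolding case_prod_unfold
  by (rule continuous_on_compose2[OF assms]) (auto intro!: continuous_intros)

lemma continuous_on_circle:
  assumes "continuous_on left_half_plane f" "t < 0"
  shows "continuous_on X (\<lambda>\<theta>. f (of_real t + \<i> * of_real \<theta>))"
  by (rule continuous_on_compose2[OF assms(1)]) (use assms in \<open>auto intro!: continuous_intros\<close>)

lemma continuous_on_modulus_powr: "continuous_on left_half_plane (modulus_powr p)"
  unfolding modulus_powr_def by (intro continuous_intros continuous_on_lam)

lemma has_vector_derivative_dt:
  assumes "\<And>s. Re s < 0 \<Longrightarrow> (f has_field_derivative f' s) (at s)" "t < 0"
  shows "((\<lambda>t. f (of_real t + \<i> * of_real \<theta>)) has_vector_derivative f' (of_real t + \<i> * of_real \<theta>)) (at t)"
  using has_vector_derivative_along_line[of f _ "\<i> * of_real \<theta>" 1 t] assms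
  by (simp add: add.commute)

lemma has_vector_derivative_dtheta:
  assumes "\<And>s. Re s < 0 \<Longrightarrow> (f has_field_derivative f' s) (at s)" "t < 0"
  shows "((\<lambda>\<theta>. f (of_real t + \<i> * of_real \<theta>)) has_vector_derivative \<i> * f' (of_real t + \<i> * of_real \<theta>)) (at \<theta>)"
  using has_vector_derivative_along_line[of f _ "of_real t" "\<i>" \<theta>] assms by simp

lemma lam_dt:
  "t < 0 \<Longrightarrow> ((\<lambda>t. lam (of_real t + \<i> * of_real \<theta>)) has_vector_derivative dlam (of_real t + \<i> * of_real \<theta>)) (at t)"
  by (intro has_vector_derivative_dt has_field_derivative_lam)

lemma lam_dtheta:
  "t < 0 \<Longrightarrow> ((\<lambda>\<theta>. lam (of_real t + \<i> * of_real \<theta>)) has_vector_derivative \<i> * dlam (of_real t + \<i> * of_real \<theta>)) (at \<theta>)"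
  by (intro has_vector_derivative_dtheta has_field_derivative_lam)

lemma dlam_dt:
  "t < 0 \<Longrightarrow> ((\<lambda>t. dlam (of_real t + \<i> * of_real \<theta>)) has_vector_derivative deriv dlam (of_real t + \<i> * of_real \<theta>)) (at t)"
  by (intro has_vector_derivative_dt has_field_derivative_dlam)

lemma dlam_dtheta:
  "t < 0 \<Longrightarrow> ((\<lambda>\<theta>. dlam (of_real t + \<i> * of_real \<theta>)) has_vector_derivative \<i> * deriv dlam (of_real t + \<i> * of_real \<theta>)) (at \<theta>)"
  by (intro has_vector_derivative_dtheta has_field_derivative_dlam)

lemma modulus_powr_dt:
  assumes "t < 0"
  shows "((\<lambda>t. modulus_powr p (of_real t + \<i> * of_real \<theta>)) has_real_derivative
    p * Re (dlam (of_real t + \<i> * of_real \<theta>)) * modulus_powr p (of_real t + \<i> * of_real \<theta>)) (at t)"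
  using DERIV_fun_exp[OF DERIV_cmult[OF has_field_derivative_Re[OF lam_dt[OF assms, of \<theta>]], of p]]
  unfolding modulus_powr_def by (simp add: mult_ac)

lemma modulus_powr_dtheta:
  assumes "t < 0"
  shows "((\<lambda>\<theta>. modulus_powr p (of_real t + \<i> * of_real \<theta>)) has_real_derivative
    - p * Im (dlam (of_real t + \<i> * of_real \<theta>)) * modulus_powr p (of_real t + \<i> * of_real \<theta>)) (at \<theta>)"
proof -
  have "((\<lambda>\<theta>. Re (lam (of_real t + \<i> * of_real \<theta>))) has_real_derivative
      - Im (dlam (of_real t + \<i> * of_real \<theta>))) (at \<theta>)"
    using has_field_derivative_Re[OF lam_dtheta[OF assms, of \<theta>]] by simp
  from DERIV_fun_exp[OF DERIV_cmult[OF this, of p]] show ?thesis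
    unfolding modulus_powr_def by (simp add: mult_ac)
qed

lemma pmean_has_derivative:
  assumes "t < 0"
  shows "(pmean p has_real_derivative pmean_slope p t) (at t)"
proof -
  have "((\<lambda>t. integral (cbox 0 (2 * pi)) (\<lambda>\<theta>. modulus_powr p (of_real t + \<i> * of_real \<theta>)))
    has_real_derivative integral (cbox 0 (2 * pi))
      (\<lambda>\<theta>. p * Re (dlam (of_real t + \<i> * of_real \<theta>)) * modulus_powr p (of_real t + \<i> * of_real \<theta>)))
      (at t within {..<0})"
    by (rule leibniz_rule_field_derivative)
      (use assms in \<open>auto intro!: has_field_derivative_at_within[OF modulus_powr_dt]
        integrable_continuous_interval continuous_on_circle continuous_on_modulus_powr
        continuous_on_polar[where f="\<lambda>s. p * Re (dlam s) * modulus_powr p s"]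
        continuous_intros continuous_on_dlam\<close>)
  then show ?thesis
    using assms unfolding pmean_def[abs_def] pmean_slope_def
    by (simp add: at_within_open[of _ "{..<0}"])
qed

text \<open>Differentiating under the integral produces the integrand
  \<open>p Re(\<Lambda>'') |\<psi>|\<^sup>p + p\<^sup>2 Re(\<Lambda>')\<^sup>2 |\<psi>|\<^sup>p\<close>, where \<open>\<Lambda>\<close> is \<^const>\<open>lam\<close>. It differs from
  \<open>p\<^sup>2 |\<Lambda>'|\<^sup>2 |\<psi>|\<^sup>p\<close> by the \<open>\<theta>\<close>-derivative of the periodic function \<open>p Im(\<Lambda>') |\<psi>|\<^sup>p\<close>.\<close>

lemma pmean_slope_has_derivative:
  assumes "t < 0"
  shows "(pmean_slope p has_real_derivative integral {0..2 * pi}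
    (\<lambda>\<theta>. p\<^sup>2 * (cmod (dlam (of_real t + \<i> * of_real \<theta>)))\<^sup>2 * modulus_powr p (of_real t + \<i> * of_real \<theta>))) (at t)"
proof -
  \<comment> \<open>\<open>g\<close> is the t-derivative of the integrand of
    \<open>pmean_slope\<close>, and \<open>h\<close> is the theta-derivative of \<open>k\<close>
    below.\<close>
  define g where "g = (\<lambda>s. (p * Re (deriv dlam s) + p\<^sup>2 * (Re (dlam s))\<^sup>2) * modulus_powr p s)"
  define h where "h = (\<lambda>s. (p * Re (deriv dlam s) - p\<^sup>2 * (Im (dlam s))\<^sup>2) * modulus_powr p s)"
  have cont_d: "continuous_on left_half_plane (deriv dlam)"
    using holomorphic_dlam open_left_half_plane
    by (intro holomorphic_on_imp_continuous_on holomorphic_deriv)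
  have cont_g: "continuous_on left_half_plane g" and cont_h: "continuous_on left_half_plane h"
    unfolding g_def h_def
    by (intro continuous_intros cont_d continuous_on_dlam continuous_on_modulus_powr)+
  have "((\<lambda>t. integral (cbox 0 (2 * pi)) (\<lambda>\<theta>. p * Re (dlam (of_real t + \<i> * of_real \<theta>)) * modulus_powr p (of_real t + \<i> * of_real \<theta>)))
    has_real_derivative integral (cbox 0 (2 * pi)) (\<lambda>\<theta>. g (of_real t + \<i> * of_real \<theta>)))
      (at t within {..<0})"
  proof (rule leibniz_rule_field_derivative)
    fix t \<theta> :: real assume t: "t \<in> {..<0}"
    let ?s = "of_real t + \<i> * of_real \<theta>"
    have "((\<lambda>t. Re (dlam (of_real t + \<i> * of_real \<theta>))) has_real_derivative Re (deriv dlam ?s)) (at t)"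
      using t by (intro has_field_derivative_Re dlam_dt) auto
    from DERIV_mult[OF DERIV_cmult[OF this, of p] modulus_powr_dt[of t p \<theta>]] t
    have "((\<lambda>t. p * Re (dlam (of_real t + \<i> * of_real \<theta>)) * modulus_powr p (of_real t + \<i> * of_real \<theta>))
        has_real_derivative g ?s) (at t)"
      by (simp add: g_def power2_eq_square algebra_simps)
    then show "((\<lambda>t. p * Re (dlam (of_real t + \<i> * of_real \<theta>)) * modulus_powr p (of_real t + \<i> * of_real \<theta>))
        has_real_derivative g ?s) (at t within {..<0})"
      by (rule has_field_derivative_at_within)
  next
    fix t :: real assume t: "t \<in> {..<0}"
    show "(\<lambda>\<theta>. p * Re (dlam (of_real t + \<i> * of_real \<theta>)) * modulus_powr p (of_real t + \<i> * of_real \<theta>))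
        integrable_on cbox 0 (2 * pi)"
      using t by (intro integrable_continuous continuous_intros continuous_on_circle continuous_on_dlam
          continuous_on_modulus_powr) auto
  qed (use assms in \<open>auto intro!: continuous_on_polar cont_g\<close>)
  then have deriv_g: "(pmean_slope p has_real_derivative
      integral {0..2 * pi} (\<lambda>\<theta>. g (of_real t + \<i> * of_real \<theta>))) (at t)"
    using assms unfolding pmean_slope_def[abs_def] by (simp add: at_within_open[of _ "{..<0}"])
  define k where "k = (\<lambda>\<theta>. p * Im (dlam (of_real t + \<i> * of_real \<theta>)) * modulus_powr p (of_real t + \<i> * of_real \<theta>))"
  have "((\<lambda>\<theta>. h (of_real t + \<i> * of_real \<theta>)) has_integral (k (2 * pi) - k 0)) {0..2 * pi}"
  proof (rule fundamental_theorem_of_calculus)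
    fix \<theta> :: real
    let ?s = "of_real t + \<i> * of_real \<theta>"
    have "((\<lambda>\<theta>. Im (dlam (of_real t + \<i> * of_real \<theta>))) has_real_derivative Re (deriv dlam ?s)) (at \<theta>)"
      using has_field_derivative_Im[OF dlam_dtheta[OF assms, of \<theta>]] by simp
    from DERIV_mult[OF DERIV_cmult[OF this, of p] modulus_powr_dtheta[OF assms, of p \<theta>]]
    have "(k has_real_derivative h ?s) (at \<theta>)"
      by (simp add: h_def k_def power2_eq_square algebra_simps)
    then show "(k has_vector_derivative h ?s) (at \<theta> within {0..2 * pi})"
      using has_field_derivative_at_within has_real_derivative_iff_has_vector_derivative by blast
  qed simp
  \<comment> \<open>A full turn adds 2 pi i to \<open>lam\<close>, leaving its real part and
    \<open>dlam\<close> unchanged, so the integral of \<open>h\<close> vanishes.\<close>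
  moreover have "k (2 * pi) = k 0"
    using dlam_periodic[of "of_real t"] lam_periodic[of "of_real t"]
    by (simp add: k_def modulus_powr_def)
  ultimately have int_h: "((\<lambda>\<theta>. h (of_real t + \<i> * of_real \<theta>)) has_integral 0) {0..2 * pi}"
    by simp
  have "integral {0..2 * pi} (\<lambda>\<theta>. g (of_real t + \<i> * of_real \<theta>))
      = integral {0..2 * pi} (\<lambda>\<theta>. g (of_real t + \<i> * of_real \<theta>) - h (of_real t + \<i> * of_real \<theta>))"
    using integral_unique[OF int_h] int_h assms
    by (subst Henstock_Kurzweil_Integration.integral_diff)
      (auto intro!: integrable_continuous_interval continuous_on_circle cont_g simp: has_integral_integrable)
  also have "(\<lambda>\<theta>. g (of_real t + \<i> * of_real \<theta>) - h (of_real t + \<i> * of_real \<theta>)) =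
      (\<lambda>\<theta>. p\<^sup>2 * (cmod (dlam (of_real t + \<i> * of_real \<theta>)))\<^sup>2 * modulus_powr p (of_real t + \<i> * of_real \<theta>))"
    by (simp add: g_def h_def cmod_power2 algebra_simps)
  finally show ?thesis
    using deriv_g by simp
qed

text \<open>\<open>F\<close> is the conformal map in logarithmic polar coordinates followed by the radial stretch
  \<open>w \<mapsto> w |w|\<^bsup>p/2-1\<^esup>\<close>. It is injective, so the integral of its Jacobian is an area inside a disk.\<close>

lemma area_estimate:
  assumes "a < b" "b < 0" "p > 0"
    and M: "\<And>s. Re s \<le> b \<Longrightarrow> modulus_powr p s \<le> M"
  shows "integral {a..b} (\<lambda>t. integral {0..2 * pi}
    (\<lambda>\<theta>. p\<^sup>2 * (cmod (dlam (of_real t + \<i> * of_real \<theta>)))\<^sup>2 * modulus_powr p (of_real t + \<i> * of_real \<theta>)))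
    \<le> 8 * p * M"
proof -
  define F where "F = (\<lambda>s. exp (of_real (p / 2 * Re (lam s)) + \<i> * of_real (Im (lam s))))"
  define F' where "F' = (\<lambda>s v. F s * (of_real (p / 2 * Re (dlam s * v)) + \<i> * of_real (Im (dlam s * v))))"
  have M0: "M \<ge> 0"
    using M[of "of_real b"] by (simp add: modulus_powr_def) (smt (verit) exp_gt_zero)
  have cmod_F: "cmod (F s) = exp (p / 2 * Re (lam s))" for s
    by (simp add: F_def)
  have cmod_F2: "(cmod (F s))\<^sup>2 = modulus_powr p s" for s
    unfolding cmod_F modulus_powr_def power2_eq_square by (simp flip: exp_add)
  have box: "Re s < b" "\<bar>Im s - Im s'\<bar> < 2 * pi"
    if "s \<in> box (Complex a 0) (Complex b (2 * pi))" "s' \<in> box (Complex a 0) (Complex b (2 * pi))" for s s'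
    using that by (auto simp: in_box_complex_iff)
  \<comment> \<open>Holomorphy of \<open>lam\<close> contributes |dlam|^2, halving p in the real
    part of the exponent contributes p/2, and the outer exponential contributes |F|^2.\<close>
  have jac: "\<bar>Im (cnj (F' s 1) * F' s \<i>)\<bar> = p / 2 * (cmod (dlam s))\<^sup>2 * modulus_powr p s" for s
  proof -
    have "Im (cnj (F' s 1) * F' s \<i>) = (cmod (F s))\<^sup>2 * (p / 2 * (cmod (dlam s))\<^sup>2)"
      unfolding F'_def cmod_power2 by (simp add: power2_eq_square algebra_simps)
    then show ?thesis
      using \<open>p > 0\<close> by (simp only: cmod_F2) (simp add: abs_mult modulus_powr_def)
  qed
  have "integral {a..b} (\<lambda>t. integral {0..2 * pi}
      (\<lambda>\<theta>. \<bar>Im (cnj (F' (Complex t \<theta>) 1) * F' (Complex t \<theta>) \<i>)\<bar>)) \<le> (2 * sqrt M)\<^sup>2"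
  proof (rule integral_jacobian_le[where F = F])
    fix s assume s: "s \<in> box (Complex a 0) (Complex b (2 * pi))"
    have d: "(lam has_derivative (\<lambda>v. dlam s * v)) (at s)"
      using has_field_derivative_lam[of s] box[OF s s] assms
      by (simp add: has_field_derivative_def)
    have "((\<lambda>s. of_real (p / 2 * Re (lam s)) + \<i> * of_real (Im (lam s))) has_derivative
        (\<lambda>v. of_real (p / 2 * Re (dlam s * v)) + \<i> * of_real (Im (dlam s * v)))) (at s)"
      by (intro derivative_intros d)
    from has_derivative_compose[OF this DERIV_exp[unfolded has_field_derivative_def]]
    show "(F has_derivative F' s) (at s)"
      by (simp add: F_def F'_def)
    show "cmod (F s) \<le> sqrt M"
      using M[of s] box[OF s s] by (intro real_le_rsqrt) (simp add: cmod_F2)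
  next
    \<comment> \<open>The modulus of F determines Re \<open>lam\<close> because p > 0, and its
      direction then determines Im \<open>lam\<close> modulo 2 pi; the open rectangle has height 2
      pi.\<close>
    show "inj_on F (box (Complex a 0) (Complex b (2 * pi)))"
    proof (rule inj_onI)
      fix s s' assume s: "s \<in> box (Complex a 0) (Complex b (2 * pi))" "s' \<in> box (Complex a 0) (Complex b (2 * pi))"
        and eq: "F s = F s'"
      then have "Re (lam s) = Re (lam s')"
        using cmod_F[of s] cmod_F[of s'] \<open>p > 0\<close> by simp
      moreover from this have "cis (Im (lam s)) = cis (Im (lam s'))"
        using eq by (simp add: F_def exp_add cis_conv_exp)
      ultimately have exp_eq: "exp (lam s) = exp (lam s')"
        by (simp only: exp_eq_polar)
      have "Re s < 0" "Re s' < 0"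
        using box(1)[OF s] box(1)[OF s(2,1)] assms(2) by linarith+
      then show "s = s'"
        using exp_eq box(2)[OF s] by (rule exp_lam_inj)
    qed
  next
    have "continuous_on ({..<0} \<times> {0..2 * pi})
        (\<lambda>(t, \<theta>). p / 2 * (cmod (dlam (of_real t + \<i> * of_real \<theta>)))\<^sup>2 * modulus_powr p (of_real t + \<i> * of_real \<theta>))"
      by (rule continuous_on_polar[where f = "\<lambda>s. p / 2 * (cmod (dlam s))\<^sup>2 * modulus_powr p s"])
        (intro continuous_intros continuous_on_dlam continuous_on_modulus_powr)
    then show "continuous_on (cbox (a, 0) (b, 2 * pi))
        (\<lambda>(t, \<theta>). \<bar>Im (cnj (F' (Complex t \<theta>) 1) * F' (Complex t \<theta>) \<i>)\<bar>)"
      unfolding jac Complex_eq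
      by (rule continuous_on_subset) (use assms in auto)
  qed (use M0 in simp)
  \<comment> \<open>The factor 2p turns the Jacobian coefficient p/2 into the p^2 of the Hardy-Stein
    integrand.\<close>
  then have "2 * p * integral {a..b} (\<lambda>t. integral {0..2 * pi}
      (\<lambda>\<theta>. p / 2 * (cmod (dlam (of_real t + \<i> * of_real \<theta>)))\<^sup>2 * modulus_powr p (of_real t + \<i> * of_real \<theta>)))
      \<le> 2 * p * (2 * sqrt M)\<^sup>2"
    using \<open>p > 0\<close> unfolding jac Complex_eq by (intro mult_left_mono) auto
  also have "\<dots> = 8 * p * M"
    using M0 by (simp add: power_mult_distrib)
  finally have le: "2 * p * integral {a..b} (\<lambda>t. integral {0..2 * pi}
      (\<lambda>\<theta>. p / 2 * (cmod (dlam (of_real t + \<i> * of_real \<theta>)))\<^sup>2 * modulus_powr p (of_real t + \<i> * of_real \<theta>)))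
      \<le> 8 * p * M" .
  have "p\<^sup>2 * x * y = 2 * p * (p / 2 * x * y)" for x y
    by (simp add: power2_eq_square)
  with le show ?thesis
    by (simp only: Henstock_Kurzweil_Integration.integral_mult_right)
qed

section \<open>Pointwise growth versus membership in Hardy spaces\<close>

subsection \<open>Hardy spaces and growth\<close>

text \<open>With b = p/q < 1, the area estimate bounds the slope of the mean by a constant plus a
  multiple of (-t)^(-b). This is integrable up to t = 0, so the means stay bounded.\<close>

lemma growth_imp_hardy:
  assumes "0 < p" "p < q" "C > 0"
    and growth: "\<And>z. z \<in> unit_disk \<Longrightarrow> cmod (\<psi> z) \<le> C * (1 - cmod z) powr (- (1 / q))"
  shows "\<psi> \<in> hardy_space p"
proof -
  define b where "b = p / q"
  have b: "0 < b" "b < 1"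
    using assms by (auto simp: b_def)
  define D where "D = C powr p"
  have "D > 0"
    using \<open>C > 0\<close> by (simp add: D_def)
  \<comment> \<open>The bound is uniform over the half-plane Re s <= t, as
    \<open>area_estimate\<close> requires.\<close>
  have bound_exp: "modulus_powr p s \<le> D * (1 - exp t) powr (- b)" if "Re s \<le> t" "t < 0" for s t
  proof -
    have "cmod (\<psi> (exp s)) \<le> C * (1 - exp (Re s)) powr (- (1 / q))"
      using growth[of "exp s"] that by simp
    then have "exp (Re (lam s)) powr p \<le> (C * (1 - exp (Re s)) powr (- (1 / q))) powr p"
      using that \<open>p > 0\<close> by (subst (asm) cmod_psi_exp) (auto intro!: powr_mono2)
    also have "\<dots> = D * (1 - exp (Re s)) powr (- b)"
      using that \<open>C > 0\<close> by (simp add: powr_mult powr_powr D_def b_def)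
    also have "\<dots> \<le> D * (1 - exp t) powr (- b)"
      using that b \<open>D > 0\<close> by (intro mult_left_mono powr_mono2') auto
    finally show ?thesis
      by (simp add: modulus_powr_def powr_def)
  qed
  \<comment> \<open>For -1 <= t < 0 one has 1 - exp t >= -t/3, because (1 - t)(1 + t/3) = 1 + (-t)(2
    + t)/3 >= 1.\<close>
  have bound: "modulus_powr p s \<le> D * (- t / 3) powr (- b)" if "Re s \<le> t" "-1 \<le> t" "t < 0" for s t
  proof -
    have "1 \<le> exp (-t) * (1 + t / 3)"
    proof -
      have "1 \<le> (1 - t) * (1 + t / 3)"
        using that mult_nonneg_nonneg[of "- t" "2 + t"] by (simp add: algebra_simps)
      also have "\<dots> \<le> exp (-t) * (1 + t / 3)"
        using that exp_ge_add_one_self[of "-t"] by (intro mult_right_mono) auto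
      finally show ?thesis .
    qed
    then have "exp t \<le> 1 + t / 3"
      by (simp add: exp_minus field_simps)
    then have "(1 - exp t) powr (- b) \<le> (- t / 3) powr (- b)"
      using that b by (intro powr_mono2') auto
    then show ?thesis
      using bound_exp[of s t] that \<open>D > 0\<close> by (smt (verit) mult_left_mono)
  qed
  \<comment> \<open>The factor 8p comes from \<open>area_estimate\<close>, the power of 1/3 from
    \<open>bound\<close>.\<close>
  define E where "E = 8 * p * D * (1 / 3) powr (- b)"
  have slope: "pmean_slope p t \<le> pmean_slope p (-1) + E * (- t) powr (- b)" if "-1 \<le> t" "t < 0" for t
  proof (cases "t = -1")
    case True
    then show ?thesis
      using \<open>D > 0\<close> \<open>p > 0\<close> by (simp add: E_def)
  next
    case False
    with that have t: "-1 < t"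
      by simp
    let ?A = "\<lambda>t. integral {0..2 * pi}
      (\<lambda>\<theta>. p\<^sup>2 * (cmod (dlam (of_real t + \<i> * of_real \<theta>)))\<^sup>2 * modulus_powr p (of_real t + \<i> * of_real \<theta>))"
    have "(?A has_integral (pmean_slope p t - pmean_slope p (-1))) {-1..t}"
    proof (rule fundamental_theorem_of_calculus)
      fix x assume "x \<in> {-1..t}"
      then have "(pmean_slope p has_real_derivative ?A x) (at x)"
        using that by (intro pmean_slope_has_derivative) auto
      then show "(pmean_slope p has_vector_derivative ?A x) (at x within {-1..t})"
        using has_field_derivative_at_within has_real_derivative_iff_has_vector_derivative by blast
    qed (use t in simp)
    then have "pmean_slope p t - pmean_slope p (-1) = integral {-1..t} ?A"
      by (rule integral_unique[symmetric])
    also have "\<dots> \<le> 8 * p * (D * (- t / 3) powr (- b))"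
      using bound that t \<open>p > 0\<close> by (intro area_estimate) auto
    also have "\<dots> = E * (- t) powr (- b)"
      using that powr_mult[of "-t" "1/3" "-b"] by (simp add: E_def)
    finally show ?thesis
      by simp
  qed
  define m where "m = pmean_slope p (-1)"
  \<comment> \<open>The mean minus an antiderivative of the slope bound, hence nonincreasing on [-1,
    0).\<close>
  define N where "N = (\<lambda>t. pmean p t - m * t + E / (1 - b) * (- t) powr (1 - b))"
  have pmean_le: "pmean p t \<le> N (-1) + \<bar>m\<bar>" if t: "-1 \<le> t" "t < 0" for t
  proof -
    have "N t \<le> N (-1)"
    proof (rule DERIV_nonpos_imp_nonincreasing[OF t(1)])
      fix x assume x: "-1 \<le> x" "x \<le> t"
      have "((\<lambda>t. (- t) powr (1 - b)) has_real_derivative - ((1 - b) * (- x) powr (- b))) (at x)"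
        using x t by (auto intro!: derivative_eq_intros)
      from DERIV_cmult[OF this, of "E / (1 - b)"]
      have d: "((\<lambda>t. E / (1 - b) * (- t) powr (1 - b)) has_real_derivative - (E * (- x) powr (- b))) (at x)"
        using b by simp
      have "(N has_real_derivative pmean_slope p x - m + - (E * (- x) powr (- b))) (at x)"
        unfolding N_def using x t
        by (intro DERIV_add DERIV_diff d pmean_has_derivative) (auto intro!: derivative_eq_intros)
      moreover have "pmean_slope p x - m + - (E * (- x) powr (- b)) \<le> 0"
        using slope[of x] x t by (simp add: m_def)
      ultimately show "\<exists>y. (N has_real_derivative y) (at x) \<and> y \<le> 0"
        by blast
    qed
    moreover have "E / (1 - b) * (- t) powr (1 - b) \<ge> 0"
      using b \<open>D > 0\<close> \<open>p > 0\<close> by (simp add: E_def)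
    moreover have "m * t \<le> \<bar>m\<bar>"
    proof -
      have "\<bar>m * t\<bar> \<le> \<bar>m\<bar> * 1"
        unfolding abs_mult using t by (intro mult_left_mono) auto
      then show ?thesis
        by linarith
    qed
    ultimately show ?thesis
      by (simp add: N_def)
  qed
  \<comment> \<open>The second entry covers radii below 1/e, where the integrand is bounded by a
    constant on an interval of length 2 pi.\<close>
  define B where "B = max (N (-1) + \<bar>m\<bar>) (D * (1 - exp (-1)) powr (- b) * (2 * pi))"
  have "integral {0..2 * pi} (\<lambda>\<theta>. cmod (\<psi> (of_real r * exp (\<i> * of_real \<theta>))) powr p) \<le> B"
    if r: "0 < r" "r < 1" for r
  proof -
    define t where "t = ln r"
    have t: "t < 0" "exp t = r"
      using r by (auto simp: t_def)
    have "pmean p t \<le> B"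
    proof (cases "-1 \<le> t")
      case True
      then show ?thesis
        using pmean_le[of t] t by (simp add: B_def)
    next
      case False
      have "pmean p t \<le> integral {0..2 * pi} (\<lambda>\<theta>. D * (1 - exp (-1)) powr (- b))"
        unfolding pmean_def using t False bound_exp[of _ "-1"]
        by (intro integral_le integrable_continuous_interval continuous_on_circle[OF continuous_on_modulus_powr])
          auto
      also have "\<dots> = D * (1 - exp (-1)) powr (- b) * (2 * pi)"
        by simp
      also have "\<dots> \<le> B"
        by (simp add: B_def)
      finally show ?thesis .
    qed
    then show ?thesis
      using t by (simp add: pmean_def modulus_powr_eq)
  qed
  then have "(SUP r\<in>{0<..<1::real}.
      ereal (integral {0..2 * pi} (\<lambda>\<theta>. cmod (\<psi> (of_real r * exp (\<i> * of_real \<theta>))) powr p))) \<le> ereal B"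
    by (intro SUP_least) simp
  then show ?thesis
    using hol_psi by (auto simp: hardy_space_def intro: le_less_trans)
qed

text \<open>|psi|^p is not the modulus of an obvious holomorphic function near the zero at 0, but
  |psi(z)/z|^p is that of exp(p L). Cauchy's formula for the latter turns the bound on means into a
  pointwise one.\<close>

lemma hardy_imp_growth:
  assumes "p > 0" "\<psi> \<in> hardy_space p"
  obtains C where "C > 0" "\<And>z. z \<in> unit_disk \<Longrightarrow> cmod (\<psi> z) powr p \<le> C / (1 - cmod z)"
proof -
  let ?I = "\<lambda>r. integral {0..2 * pi} (\<lambda>\<theta>. cmod (\<psi> (of_real r * exp (\<i> * of_real \<theta>))) powr p)"
  let ?S = "SUP r\<in>{0<..<1::real}. ereal (?I r)"
  have "?S < \<infinity>"
    using assms by (simp add: hardy_space_def)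
  then obtain B0 where B0: "?S < ereal B0"
    using less_PInf_Ex_of_nat by auto
  define B where "B = max B0 1"
  have B: "?I r \<le> B" if "0 < r" "r < 1" for r
  proof -
    have "ereal (?I r) \<le> ?S"
      using that by (intro SUP_upper) auto
    with B0 show ?thesis
      by (simp add: B_def) (smt (verit) ereal_less_eq(3) less_imp_le order_trans)
  qed
  define g where "g = (\<lambda>z. exp (of_real p * L z))"
  have hol_g: "g holomorphic_on unit_disk"
    unfolding g_def by (intro holomorphic_intros hol_L)
  have cmod_psi: "cmod (\<psi> z) powr p = cmod z powr p * cmod (g z)" if "z \<in> unit_disk" for z
    using that by (simp add: psi_eq norm_mult powr_mult g_def powr_def[of "exp _"])
  have cmod_g: "cmod (g z) \<le> 2 powr p * B / (pi * (1 - cmod z))" if z: "z \<in> unit_disk" for z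
  proof -
    \<comment> \<open>The radius halfway between |z| and 1 keeps the Cauchy kernel below 2 / (1 -
      |z|) and is at least 1/2.\<close>
    define \<rho> where "\<rho> = (1 + cmod z) / 2"
    have \<rho>: "1 / 2 \<le> \<rho>" "\<rho> < 1" "cmod z < \<rho>" "\<rho> - cmod z = (1 - cmod z) / 2" "0 < \<rho>"
      using z by (auto simp: \<rho>_def field_simps add_pos_nonneg)
    have "cball 0 \<rho> \<subseteq> unit_disk"
      using \<rho> by auto
    then have "((\<lambda>u. g u / (u - z)) has_contour_integral (2 * of_real pi * \<i> * g z)) (circlepath 0 \<rho>)"
      using hol_g \<rho> by (intro Cauchy_integral_circlepath_simple) (auto intro: holomorphic_on_subset)
    then have cauchy: "((\<lambda>t. g (of_real \<rho> * cis t) / (of_real \<rho> * cis t - z) * of_real \<rho> * \<i> * cis t)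
        has_integral (2 * of_real pi * \<i> * g z)) {0..2 * pi}"
      unfolding circlepath_def by (subst (asm) has_contour_integral_part_circlepath_iff) auto
    let ?c = "2 powr p / (\<rho> - cmod z)"
    have in_disk: "of_real \<rho> * cis t \<in> unit_disk" for t
      using \<rho>(2,5) by (simp add: norm_mult)
    have "cmod (2 * of_real pi * \<i> * g z) \<le>
        integral {0..2 * pi} (\<lambda>t. ?c * cmod (\<psi> (of_real \<rho> * cis t)) powr p)"
      unfolding integral_unique[OF cauchy, symmetric]
    proof (rule integral_norm_bound_integral)
      have "continuous_on {0..2 * pi} (\<lambda>t. \<psi> (of_real \<rho> * cis t))"
        using in_disk
        by (intro continuous_on_compose2[OF holomorphic_on_imp_continuous_on[OF hol_psi]] continuous_intros) auto
      then show "(\<lambda>t. ?c * cmod (\<psi> (of_real \<rho> * cis t)) powr p) integrable_on {0..2 * pi}"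
        using \<open>p > 0\<close>
        by (intro integrable_continuous_interval continuous_on_mult continuous_on_const
            continuous_on_powr' continuous_on_norm) auto
      fix t :: real
      let ?w = "of_real \<rho> * cis t"
      \<comment> \<open>Since the radius is at least 1/2, dividing |psi|^p by its p-th power costs
        at most 2^p.\<close>
      have "1 \<le> (2 * \<rho>) powr p"
        using \<rho>(1) \<open>p > 0\<close> by (intro ge_one_powr_ge_zero) auto
      then have "cmod (g ?w) \<le> (2 * \<rho>) powr p * cmod (g ?w)"
        using mult_right_mono[of 1 _ "cmod (g ?w)"] by simp
      also have "\<dots> = 2 powr p * cmod (\<psi> ?w) powr p"
        using \<rho>(5) by (simp add: cmod_psi[OF in_disk] norm_mult powr_mult)
      finally have 1: "cmod (g ?w) \<le> 2 powr p * cmod (\<psi> ?w) powr p" .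
      have 2: "\<rho> - cmod z \<le> cmod (?w - z)"
        using norm_triangle_ineq2[of ?w z] \<rho>(5) by (simp add: norm_mult)
      have "norm (g ?w / (?w - z) * of_real \<rho> * \<i> * cis t) = cmod (g ?w) * \<rho> / cmod (?w - z)"
        using \<rho>(5) by (simp add: norm_mult norm_divide)
      also have "\<dots> \<le> (2 powr p * cmod (\<psi> ?w) powr p * 1) / (\<rho> - cmod z)"
        using 1 2 \<rho>(2,3,5) by (intro frac_le mult_mono) auto
      finally show "norm (g ?w / (?w - z) * of_real \<rho> * \<i> * cis t) \<le> ?c * cmod (\<psi> ?w) powr p"
        by simp
    qed (use cauchy in \<open>simp add: has_integral_integrable\<close>)
    also have "\<dots> = ?c * ?I \<rho>"
      by (simp add: cis_conv_exp)
    also have "\<dots> \<le> ?c * B"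
      using B[of \<rho>] \<rho>(2,3,5) by (intro mult_left_mono) auto
    finally have "cmod (g z) * (2 * pi) \<le> ?c * B"
      by (simp add: norm_mult mult_ac)
    also have "?c * B = (2 powr p * B / (pi * (1 - cmod z))) * (2 * pi)"
    proof -
      have "x / (d / 2) * y = x * y / (pi * d) * (2 * pi)" for x y d :: real
        by (cases "d = 0") (auto simp: field_simps)
      then show ?thesis
        by (simp only: \<rho>(4))
    qed
    finally show ?thesis
      by (rule mult_right_le_imp_le) simp
  qed
  show ?thesis
  proof
    show "2 powr p * B / pi > 0"
      by (simp add: B_def)
    fix z assume z: "z \<in> unit_disk"
    have "cmod (\<psi> z) powr p \<le> 1 * cmod (g z)"
      unfolding cmod_psi[OF z] using z \<open>p > 0\<close> by (intro mult_right_mono powr_le1) auto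
    with cmod_g[OF z] show "cmod (\<psi> z) powr p \<le> 2 powr p * B / pi / (1 - cmod z)"
      by simp
  qed
qed

end

section \<open>Hyperbolic distance to level sets and the Hardy number\<close>

subsection \<open>The Hardy number\<close>

text \<open>The quotient psi(z)/z, with value psi'(0) at 0, is holomorphic and zero-free because
  \<open>\<psi>\<close> is injective. The disk is contractible, so the quotient has a holomorphic
  logarithm.\<close>

lemma conformal_map_log:
  assumes "conformal_map \<psi>" "\<psi> 0 = 0"
  obtains L where "conformal_log \<psi> L"
proof -
  have hol: "\<psi> holomorphic_on unit_disk" and inj: "inj_on \<psi> unit_disk"
    using assms(1) by (auto simp: conformal_map_def)
  define f where "f = (\<lambda>z. if z = 0 then deriv \<psi> 0 else (\<psi> z - \<psi> 0) / (z - 0))"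
  have hol_f: "f holomorphic_on unit_disk"
    unfolding f_def by (intro pole_lemma_open hol) auto
  have nz: "f z \<noteq> 0" if "z \<in> unit_disk" for z
  proof (cases "z = 0")
    case True
    then show ?thesis
      using holomorphic_injective_imp_regular[OF hol _ inj that] by (simp add: f_def)
  next
    case False
    then have "\<psi> z \<noteq> \<psi> 0"
      using inj that by (auto dest: inj_onD)
    then show ?thesis
      using False by (simp add: f_def)
  qed
  obtain L where L: "L holomorphic_on unit_disk" "\<And>z. z \<in> unit_disk \<Longrightarrow> f z = exp (L z)"
    using contractible_imp_holomorphic_log[OF hol_f convex_imp_contractible[OF convex_ball] nz] by metis
  have "\<psi> z = z * exp (L z)" if "z \<in> unit_disk" for z
    using L(2)[OF that] assms(2) by (cases "z = 0") (auto simp: f_def field_simps)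
  with L(1) inj have "conformal_log \<psi> L"
    by unfold_locales auto
  then show ?thesis
    using that by blast
qed

lemma hyp_dist_0: "hyp_dist 0 z = ln ((1 + cmod z) / (1 - cmod z))"
  by (simp add: hyp_dist_def)

theorem theorem1p1:
  fixes \<psi> :: "complex \<Rightarrow> complex"
  assumes "conformal_map \<psi>"
    and "\<psi> 0 = 0"
  shows "hardy_number \<psi> =
    Liminf at_top (\<lambda>\<alpha>::real. hyp_dist_set 0 (level_set \<psi> \<alpha>) / ereal (ln \<alpha>))"
proof -
  obtain L where "conformal_log \<psi> L"
    using conformal_map_log assms by blast
  then interpret conformal_log \<psi> L .
  let ?X = "\<lambda>\<alpha>::real. hyp_dist_set 0 (level_set \<psi> \<alpha>) / ereal (ln \<alpha>)"
  have h_ge: "ereal p \<le> hardy_number \<psi>" if "p > 0" "\<psi> \<in> hardy_space p" for p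
    unfolding hardy_number_def using that by (intro SUP_upper) auto
  show ?thesis
  proof (rule antisym)
    show "hardy_number \<psi> \<le> Liminf at_top ?X"
      unfolding hardy_number_def
    proof (rule SUP_least)
      fix p assume "p \<in> {p. p > 0 \<and> \<psi> \<in> hardy_space p}"
      then have p: "p > 0" "\<psi> \<in> hardy_space p"
        by auto
      obtain C where C: "C > 0" "\<And>z. z \<in> unit_disk \<Longrightarrow> cmod (\<psi> z) powr p \<le> C / (1 - cmod z)"
        using hardy_imp_growth[OF p] by blast
      \<comment> \<open>Requiring alpha > 1 makes the divisor ln alpha positive. An empty level set
        is harmless, its distance being infinite.\<close>
      have "ereal ((p * ln \<alpha> - ln C) / ln \<alpha>) \<le> ?X \<alpha>" if \<alpha>: "\<alpha> > 1" for \<alpha>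
      proof -
        have "ereal (p * ln \<alpha> - ln C) \<le> hyp_dist_set 0 (level_set \<psi> \<alpha>)"
          unfolding hyp_dist_set_def
        proof (rule INF_greatest)
          fix z assume "z \<in> level_set \<psi> \<alpha>"
          then have z: "z \<in> unit_disk" "cmod (\<psi> z) = \<alpha>"
            by (auto simp: level_set_def)
          have "p * ln \<alpha> = ln (\<alpha> powr p)"
            using \<alpha> by (simp add: ln_powr)
          also have "\<dots> \<le> ln (C / (1 - cmod z))"
            using C(2)[OF z(1)] z \<alpha> C(1) by (subst ln_le_cancel_iff) auto
          also have "\<dots> \<le> ln (C * ((1 + cmod z) / (1 - cmod z)))"
            using z C(1) by (subst ln_le_cancel_iff) (auto intro!: divide_right_mono divide_pos_pos mult_pos_pos add_pos_nonneg)
          also have "\<dots> = ln C + hyp_dist 0 z"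
            unfolding hyp_dist_0 using z C(1) by (intro ln_mult_pos) (auto intro!: divide_pos_pos add_pos_nonneg)
          finally show "ereal (p * ln \<alpha> - ln C) \<le> ereal (hyp_dist 0 z)"
            by simp
        qed
        then have "ereal (p * ln \<alpha> - ln C) / ereal (ln \<alpha>) \<le> ?X \<alpha>"
          using \<alpha> by (intro ereal_divide_right_mono) auto
        then show ?thesis
          using \<alpha> by simp
      qed
      then have "Liminf at_top (\<lambda>\<alpha>. ereal ((p * ln \<alpha> - ln C) / ln \<alpha>)) \<le> Liminf at_top ?X"
        by (intro Liminf_mono eventually_mono[OF eventually_gt_at_top[of 1]]) auto
      moreover have "((\<lambda>\<alpha>. (p * ln \<alpha> - ln C) / ln \<alpha>) \<longlongrightarrow> p) at_top"
        by real_asymp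
      then have "Liminf at_top (\<lambda>\<alpha>. ereal ((p * ln \<alpha> - ln C) / ln \<alpha>)) = ereal p"
        by (intro lim_imp_Liminf) auto
      ultimately show "ereal p \<le> Liminf at_top ?X"
        by simp
    qed
  next
    obtain C K where CK: "C > 0" "K > 0"
      "\<And>z. z \<in> unit_disk \<Longrightarrow> cmod (\<psi> z) \<le> C * (1 - cmod z) powr (- K)"
      using polynomial_growth by blast
    \<comment> \<open>Any positive exponent below 1/K would do. One member of the index set keeps
      the supremum from being that of the empty set, minus infinity.\<close>
    have "\<psi> \<in> hardy_space (1 / (2 * K))"
      by (rule growth_imp_hardy[where q = "1 / K" and C = C]) (use CK in \<open>auto simp: field_simps\<close>)
    from h_ge[OF _ this] have h_nonneg: "0 \<le> hardy_number \<psi>"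
      using CK by (smt (verit) divide_pos_pos ereal_less_eq(5) order_trans)
    show "Liminf at_top ?X \<le> hardy_number \<psi>"
    proof (rule dense_le)
      fix y assume "y < Liminf at_top ?X"
      then obtain p where p: "y < ereal p" "ereal p < Liminf at_top ?X"
        using ereal_dense2 by blast
      \<comment> \<open>Growth of order 1/q yields membership only for exponents strictly below q,
        hence two reals under the lower limit.\<close>
      then obtain q where q: "ereal p < ereal q" "ereal q < Liminf at_top ?X"
        using ereal_dense2 by blast
      show "y \<le> hardy_number \<psi>"
      proof (cases "p > 0")
        case False
        then have "y \<le> 0"
          using p(1) by (metis ereal_less_eq(5) le_less_trans less_imp_le not_le zero_ereal_def ereal_less_eq(3))
        then show ?thesis
          using h_nonneg by (rule order_trans)
      next
        case True
        obtain A where A: "\<And>\<alpha>. \<alpha> \<ge> A \<Longrightarrow> ereal q < ?X \<alpha>"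
          using less_LiminfD[OF q(2)] unfolding eventually_at_top_linorder by blast
        \<comment> \<open>Values above M are beyond the threshold A and exceed 2, so their logarithm
          is positive; smaller values are bounded by M itself.\<close>
        define M where "M = max A 2"
        have pq: "0 < p" "p < q" "0 < q"
          using True q by auto
        have "cmod (\<psi> z) \<le> (M + 2 powr (1 / q)) * (1 - cmod z) powr (- (1 / q))" if z: "z \<in> unit_disk" for z
        proof -
          have one: "1 \<le> (1 - cmod z) powr (- (1 / q))"
            using z pq by (simp add: powr_minus one_le_inverse_iff powr_le1)
          show ?thesis
          proof (cases "cmod (\<psi> z) \<le> M")
            case True
            also have "M \<le> (M + 2 powr (1 / q)) * 1"
              by simp
            also have "\<dots> \<le> (M + 2 powr (1 / q)) * (1 - cmod z) powr (- (1 / q))"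
              using one by (intro mult_left_mono) (auto simp: M_def)
            finally show ?thesis .
          next
            case False
            define \<alpha> where "\<alpha> = cmod (\<psi> z)"
            have \<alpha>: "\<alpha> \<ge> A" "\<alpha> > 2"
              using False by (auto simp: \<alpha>_def M_def)
            \<comment> \<open>The point z lies on its own level set, so d(0, z) bounds the distance
              to that set from above.\<close>
            have "ereal q * ereal (ln \<alpha>) \<le> hyp_dist_set 0 (level_set \<psi> \<alpha>)"
              using A[OF \<alpha>(1)] \<alpha>(2) ereal_less_divide_pos[of "ereal (ln \<alpha>)" "ereal q"]
              by (simp add: mult.commute less_imp_le)
            also have "\<dots> \<le> ereal (hyp_dist 0 z)"
              unfolding hyp_dist_set_def using z by (intro INF_lower) (auto simp: level_set_def \<alpha>_def)
            finally have "q * ln \<alpha> \<le> ln ((1 + cmod z) / (1 - cmod z))"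
              by (simp add: hyp_dist_0)
            also have "\<dots> \<le> ln (2 / (1 - cmod z))"
              using z by (subst ln_le_cancel_iff) (auto intro!: divide_right_mono divide_pos_pos add_pos_nonneg)
            finally have "ln \<alpha> \<le> (1 / q) * ln (2 / (1 - cmod z))"
              using pq by (simp add: field_simps)
            then have "\<alpha> \<le> (2 / (1 - cmod z)) powr (1 / q)"
              using \<alpha> z by (subst ln_le_cancel_iff[symmetric]) (auto simp: ln_powr)
            also have "\<dots> = 2 powr (1 / q) * (1 - cmod z) powr (- (1 / q))"
              using z by (simp add: powr_divide powr_minus field_simps)
            also have "\<dots> \<le> (M + 2 powr (1 / q)) * (1 - cmod z) powr (- (1 / q))"
              by (intro mult_right_mono) (auto simp: M_def)
            finally show ?thesis
              by (simp add: \<alpha>_def)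
          qed
        qed
        then have "\<psi> \<in> hardy_space p"
          using pq by (intro growth_imp_hardy[where q = q and C = "M + 2 powr (1 / q)"])
            (auto simp: M_def add_pos_pos)
        then have "ereal p \<le> hardy_number \<psi>"
          using pq by (intro h_ge)
        then show ?thesis
          using p(1) by (meson less_imp_le order_trans)
      qed
    qed
  qed
qed

end
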